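(* Let $n,k$ be positive integers with $n\ge\binom{k+1}{2}$. The subposet $NG_1(n,k)$ of $S\text{-}Block(n)$ is an amphora, consisting of exactly those $S$-blocks in $S\text{-}Block(n)$ that majorize $[\tau_k(n)|\tau'_k(n)]$ and are majorized by some NG-1 element of $(Max)^n_k$. Similarly, $NG_2(n,k)$ is an amphora, consisting of exactly those $S$-blocks in $S\text{-}Block(n)$ that majorize $[\tau_k(n)|\tau'_k(n)]$ and are majorized by some NG-2 element of $(Max)^n_k$.
   Context: $Dis(n)$ is the set of partitions $\gamma=(g_1,\dots,g_r)$ of $n$ into distinct positive parts $g_1>\dots>g_r>0$, with $\mathrm{len}(\gamma)=r$; $Dis_k(n)$ is the subset of those with exactly $k$ parts. For $\gamma=(g_1,\dots,g_r)$ and $\delta=(d_1,\dots,d_s)$ in $Dis(n)$, $\delta\succeq\gamma$ ($\delta$ majorizes $\gamma$) means $\sum_{i=1}^m d_i\ge\sum_{i=1}^m g_i$ for all $m\le\min\{r,s\}$. An $S$-block is an ordered pair $[\alpha|\beta]$ with $\alpha,\beta\in Dis(n)$, $\beta\succeq\alpha$, and $\mathrm{len}(\alpha)\in\{\mathrm{len}(\beta),\mathrm{len}(\beta)+1\}$. $S\text{-}Block(n)$ is the poset of all such $S$-blocks, where $[\alpha_1|\beta_1]$ majorizes $[\alpha_2|\beta_2]$, written $[\alpha_1|\beta_1]\succeq[\alpha_2|\beta_2]$, iff $\alpha_1\succeq\alpha_2$ and $\beta_1\preceq\beta_2$. $A(n,k)$ is the subposet of $S$-blocks $[\alpha|\beta]$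 with $\alpha,\beta\in Dis_k(n)$, and $(Max)^n_k=\{[\gamma|\gamma]:\gamma\in Dis_k(n)\}$. For $n\ge\binom{k+1}{2}$, $\tau'_k(n)=(n-\binom k2,k-1,k-2,\dots,2,1)$; and, writing $n-\binom{k+1}{2}=qk+r$ with $0\le r<k$, $\tau_k(n)$ is the partition whose $i$-th part is $\hat s_i+(k-i+1)$, where $\hat s_i=q+1$ for $1\le i\le r$ and $\hat s_i=q$ for $r<i\le k$. Graphs are finite and simple, without isolated vertices. For a degree sequence $\pi=(d_1\ge\dots\ge d_r)$, $\alpha(\pi)$ has $i$-th part $d_i-i+1$ for those $i$ with $d_i\ge i$, and $\beta(\pi)$ has $j$-th part $|\{i:d_i\ge j\}|-j$ for those $j$ for which this is positive. A graph $G$ is an NG-graph if $\chi(G)+\chi(\overline G)=|V(G)|+1$. With $A_G=\{v:\deg(v)=\chi(G)-1\}$, an NG-graph is NG-1 if $G[A_G]$ is a clique and NG-2 if $G[A_G]$ is a stable set. An $S$-block $[\alpha|\beta]$ is called NG-1 (resp. NG-2) if there is an NG-1 (resp. NG-2) graph with degree sequence $\pi$ such that $\alpha=\alpha(\pi)$, $\beta=\beta(\pi)$. $NG_1(n,k)$ (resp. $NG_2(n,k)$) is the subposet of $A(n,k)$ consisting of its NG-1 (resp. NG-2) $S$-blocks. Given a poset $P$, a subposet $P'$ is an amphora if there exist an antichain $A$ in $P$ and an element $x$ less than or equal to every element of $A$ such that $P'$ consists of all elements of $P$ that are greater than or equal to $x$ and less than or equal to some element of $A$. The antichain $A$ may be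 empty, so the empty set counts as an amphora. *)

theory Defs
  imports Complex_Main "HOL-Library.Multiset" "HOL-Library.Ramsey"
begin

section \<open>Partitions into distinct parts and majorization\<close>

text \<open>A partition is the list of its parts in weakly decreasing order; the part with
  one-based index \<open>i\<close> is \<open>\<gamma> ! (i - 1)\<close>.\<close>

definition Dis :: "nat \<Rightarrow> nat list set" where
  "Dis n = {\<gamma>. sorted_wrt (>) \<gamma> \<and> (\<forall>g\<in>set \<gamma>. g > 0) \<and> sum_list \<gamma> = n}"

definition Dis_k :: "nat \<Rightarrow> nat \<Rightarrow> nat list set" where
  "Dis_k k n = {\<gamma> \<in> Dis n. length \<gamma> = k}"

definition majorizes :: "nat list \<Rightarrow> nat list \<Rightarrow> bool" (infix \<open>\<succeq>\<close> 50) where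
  "\<delta> \<succeq> \<gamma> \<longleftrightarrow>
     (\<forall>m \<le> min (length \<gamma>) (length \<delta>). sum_list (take m \<delta>) \<ge> sum_list (take m \<gamma>))"

definition tau' :: "nat \<Rightarrow> nat \<Rightarrow> nat list" where
  "tau' k n = (n - (k choose 2)) # rev [1..<k]"

definition tau :: "nat \<Rightarrow> nat \<Rightarrow> nat list" where
  "tau k n =
     (let q = (n - ((k + 1) choose 2)) div k; r = (n - ((k + 1) choose 2)) mod k
      in map (\<lambda>i. (if i \<le> r then q + 1 else q) + (k - i + 1)) [1..<k + 1])"


section \<open>The poset of S-blocks\<close>

type_synonym block = "nat list \<times> nat list"

definition S_Block :: "nat \<Rightarrow> block set" where
  "S_Block n = {(\<alpha>, \<beta>). \<alpha> \<in> Dis n \<and> \<beta> \<in> Dis n \<and> \<beta> \<succeq> \<alpha> \<and>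
     length \<alpha> \<in> {length \<beta>, length \<beta> + 1}}"

definition block_majorizes :: "block \<Rightarrow> block \<Rightarrow> bool" (infix \<open>\<succeq>\<^sub>B\<close> 50) where
  "X \<succeq>\<^sub>B Y \<longleftrightarrow> fst X \<succeq> fst Y \<and> snd Y \<succeq> snd X"

definition A_blocks :: "nat \<Rightarrow> nat \<Rightarrow> block set" where
  "A_blocks n k = {(\<alpha>, \<beta>) \<in> S_Block n. \<alpha> \<in> Dis_k k n \<and> \<beta> \<in> Dis_k k n}"

definition Max_blocks :: "nat \<Rightarrow> nat \<Rightarrow> block set" where
  "Max_blocks n k = {(\<gamma>, \<gamma>) | \<gamma>. \<gamma> \<in> Dis_k k n}"

definition amphora :: "'a set \<Rightarrow> ('a \<Rightarrow> 'a \<Rightarrow> bool) \<Rightarrow> 'a set \<Rightarrow> bool" where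
  "amphora P le Q \<longleftrightarrow>
     (\<exists>A x. A \<subseteq> P \<and> (\<forall>a\<in>A. \<forall>b\<in>A. a \<noteq> b \<longrightarrow> \<not> le a b) \<and>
            x \<in> P \<and> (\<forall>a\<in>A. le x a) \<and>
            Q = {y \<in> P. le x y \<and> (\<exists>a\<in>A. le y a)})"

lemma majorizes_length:
  assumes "\<gamma> \<in> Dis n" "\<delta> \<in> Dis n" "\<delta> \<succeq> \<gamma>"
  shows "length \<delta> \<le> length \<gamma>"
proof (rule ccontr)
  assume "\<not> length \<delta> \<le> length \<gamma>"
  then have l: "length \<gamma> < length \<delta>" by simp
  then have "sum_list (take (length \<gamma>) \<delta>) \<ge> n"
    using assms by (auto simp: majorizes_def Dis_def)
  moreover have "sum_list (take (length \<gamma>) \<delta>) + sum_list (drop (length \<gamma>) \<delta>) = n"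
    using assms(2) by (simp add: Dis_def flip: sum_list_append)
  ultimately have "sum_list (drop (length \<gamma>) \<delta>) = 0" by linarith
  moreover have "\<delta> ! length \<gamma> \<in> set (drop (length \<gamma>) \<delta>)"
    using l by (metis Cons_nth_drop_Suc list.set_intros(1))
  ultimately have "\<delta> ! length \<gamma> = 0" by (simp add: sum_list_eq_0_iff)
  with l assms(2) nth_mem[OF l] show False by (fastforce simp: Dis_def)
qed

lemma majorizes_trans:
  assumes "\<alpha> \<in> Dis n" "\<beta> \<in> Dis n" "\<gamma> \<in> Dis n" "\<gamma> \<succeq> \<beta>" "\<beta> \<succeq> \<alpha>"
  shows "\<gamma> \<succeq> \<alpha>"
  unfolding majorizes_def
proof (intro allI impI)
  fix m assume m: "m \<le> min (length \<alpha>) (length \<gamma>)"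
  have "length \<gamma> \<le> length \<beta>" "length \<beta> \<le> length \<alpha>"
    using assms majorizes_length by blast+
  with m assms(4,5) have "sum_list (take m \<alpha>) \<le> sum_list (take m \<beta>)"
    "sum_list (take m \<beta>) \<le> sum_list (take m \<gamma>)"
    by (auto simp: majorizes_def)
  then show "sum_list (take m \<alpha>) \<le> sum_list (take m \<gamma>)" by simp
qed

lemma majorizes_antisym:
  assumes "\<alpha> \<in> Dis n" "\<beta> \<in> Dis n" "\<alpha> \<succeq> \<beta>" "\<beta> \<succeq> \<alpha>"
  shows "\<alpha> = \<beta>"
proof (rule nth_equalityI)
  show l: "length \<alpha> = length \<beta>"
    using assms majorizes_length by (meson le_antisym)
  have eq: "sum_list (take m \<alpha>) = sum_list (take m \<beta>)" if "m \<le> length \<alpha>" for m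
    using that l assms(3,4) by (auto simp: majorizes_def intro!: le_antisym)
  fix i assume "i < length \<alpha>"
  then show "\<alpha> ! i = \<beta> ! i"
    using eq[of i] eq[of "Suc i"] l by (simp add: take_Suc_conv_app_nth)
qed

theorem S_Block_poset:
  "partial_order_on (S_Block n) {(Y, X). Y \<in> S_Block n \<and> X \<in> S_Block n \<and> X \<succeq>\<^sub>B Y}"
proof -
  let ?r = "{(Y, X). Y \<in> S_Block n \<and> X \<in> S_Block n \<and> X \<succeq>\<^sub>B Y}"
  have "refl_on (S_Block n) ?r"
    by (auto simp: refl_on_def block_majorizes_def majorizes_def)
  moreover have "trans ?r"
    by (rule transI) (auto simp: S_Block_def block_majorizes_def intro: majorizes_trans)
  moreover have "antisym ?r"
    by (rule antisymI) (auto simp: S_Block_def block_majorizes_def intro: majorizes_antisym)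
  ultimately show ?thesis
    by (auto simp: partial_order_on_def preorder_on_def)
qed


section \<open>Graphs and NG-graphs\<close>

text \<open>A graph is given by its vertex set \<open>V\<close> and its edge set \<open>E\<close>, whose elements are
  two-element subsets of \<open>V\<close>, matching \<^const>\<open>clique\<close> and \<^const>\<open>indep\<close>
  of \<^theory>\<open>HOL-Library.Ramsey\<close>.\<close>

definition fin_graph :: "'a set \<Rightarrow> 'a set set \<Rightarrow> bool" where
  "fin_graph V E \<longleftrightarrow> finite V \<and> E \<subseteq> [V]\<^bsup>2\<^esup>"

definition no_isolated :: "'a set \<Rightarrow> 'a set set \<Rightarrow> bool" where
  "no_isolated V E \<longleftrightarrow> (\<forall>v\<in>V. \<exists>e\<in>E. v \<in> e)"

definition deg :: "'a set set \<Rightarrow> 'a \<Rightarrow> nat" where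
  "deg E v = card {e \<in> E. v \<in> e}"

definition compl_edges :: "'a set \<Rightarrow> 'a set set \<Rightarrow> 'a set set" where
  "compl_edges V E = [V]\<^bsup>2\<^esup> - E"

definition colorable :: "'a set \<Rightarrow> 'a set set \<Rightarrow> nat \<Rightarrow> bool" where
  "colorable V E m \<longleftrightarrow>
     (\<exists>c :: 'a \<Rightarrow> nat. (\<forall>v\<in>V. c v < m) \<and>
        (\<forall>u\<in>V. \<forall>v\<in>V. {u, v} \<in> E \<longrightarrow> c u \<noteq> c v))"

definition chromatic_number :: "'a set \<Rightarrow> 'a set set \<Rightarrow> nat" where
  "chromatic_number V E = (LEAST m. colorable V E m)"

definition degree_seq :: "'a set \<Rightarrow> 'a set set \<Rightarrow> nat list" where
  "degree_seq V E = rev (sorted_list_of_multiset (image_mset (deg E) (mset_set V)))"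

definition NG_graph :: "'a set \<Rightarrow> 'a set set \<Rightarrow> bool" where
  "NG_graph V E \<longleftrightarrow> fin_graph V E \<and> no_isolated V E \<and>
     chromatic_number V E + chromatic_number V (compl_edges V E) = card V + 1"

definition A_vertices :: "'a set \<Rightarrow> 'a set set \<Rightarrow> 'a set" where
  "A_vertices V E = {v \<in> V. deg E v = chromatic_number V E - 1}"

definition NG1_graph :: "'a set \<Rightarrow> 'a set set \<Rightarrow> bool" where
  "NG1_graph V E \<longleftrightarrow> NG_graph V E \<and> clique (A_vertices V E) E"

definition NG2_graph :: "'a set \<Rightarrow> 'a set set \<Rightarrow> bool" where
  "NG2_graph V E \<longleftrightarrow> NG_graph V E \<and> indep (A_vertices V E) E"


section \<open>From degree sequences to blocks\<close>

definition alpha_of :: "nat list \<Rightarrow> nat list" where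
  "alpha_of \<pi> =
     map (\<lambda>i. \<pi> ! (i - 1) - i + 1) (filter (\<lambda>i. \<pi> ! (i - 1) \<ge> i) [1..<length \<pi> + 1])"

text \<open>In the following definition the indices \<open>j > length \<pi>\<close> can be left out,
  since the conjugate part is at most \<open>length \<pi>\<close>.\<close>

definition conj_part :: "nat list \<Rightarrow> nat \<Rightarrow> nat" where
  "conj_part \<pi> j = card {i \<in> {1..length \<pi>}. \<pi> ! (i - 1) \<ge> j}"

definition beta_of :: "nat list \<Rightarrow> nat list" where
  "beta_of \<pi> =
     map (\<lambda>j. conj_part \<pi> j - j) (filter (\<lambda>j. conj_part \<pi> j > j) [1..<length \<pi> + 1])"

text \<open>Every finite graph has an isomorphic copy on a set of natural numbers, so it is no
  restriction to take the vertices in \<^typ>\<open>nat\<close>.\<close>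

definition NG1_block :: "block \<Rightarrow> bool" where
  "NG1_block X \<longleftrightarrow> (\<exists>(V :: nat set) E. NG1_graph V E \<and>
     X = (alpha_of (degree_seq V E), beta_of (degree_seq V E)))"

definition NG2_block :: "block \<Rightarrow> bool" where
  "NG2_block X \<longleftrightarrow> (\<exists>(V :: nat set) E. NG2_graph V E \<and>
     X = (alpha_of (degree_seq V E), beta_of (degree_seq V E)))"

definition NG1 :: "nat \<Rightarrow> nat \<Rightarrow> block set" where
  "NG1 n k = {X \<in> A_blocks n k. NG1_block X}"

definition NG2 :: "nat \<Rightarrow> nat \<Rightarrow> block set" where
  "NG2 n k = {X \<in> A_blocks n k. NG2_block X}"

end

theory Submission
  imports Defs
begin

text \<open>
  The theorem becomes a statement about two numbers, because for a block \<open>[\<alpha>|\<beta>]\<close> whose entries both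
  have \<open>k > 0\<close> parts,

    \<^item> the block is NG-1 if and only if the last part of \<open>\<beta>\<close> is \<open>1\<close> (\<open>NG1_block_iff\<close>), and

    \<^item> it is NG-2 if and only if the last part of \<open>\<alpha>\<close> is at least \<open>2\<close> (\<open>NG2_block_iff\<close>).

  Among partitions of \<open>n\<close> into \<open>k\<close> parts, majorizing can only decrease the last part. If
  \<open>\<beta> \<succeq> \<gamma> \<succeq> \<alpha>\<close>, then a last part \<open>1\<close> of \<open>\<gamma>\<close> therefore passes to \<open>\<beta>\<close>, and a last part
  \<open>\<ge> 2\<close> of \<open>\<gamma>\<close> passes to \<open>\<alpha>\<close>: being NG-1 or NG-2 is inherited from the diagonal block
  \<open>[\<gamma>|\<gamma>]\<close>. Conversely an NG-1 block lies below the NG-1 block \<open>[\<beta>|\<beta>]\<close>, and an NG-2 block below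
  the NG-2 block \<open>[\<alpha>|\<alpha>]\<close>. As \<open>tau\<close> and \<open>tau'\<close> are the least and the greatest partition
  with \<open>k\<close> parts, and as a majorizing partition is never the longer one, the blocks between \<open>[tau|tau']\<close> and the
  diagonal are exactly those with both lengths equal to \<open>k\<close>. Different diagonal blocks are never
  comparable, which gives the antichain.

  The two equivalences come from an edge count. Let a graph have a block with both lengths equal to \<open>k\<close>
  and let \<open>K\<close> be its \<open>k\<close> vertices of largest degree. The equality of the sums of \<open>\<alpha>\<close> and
  \<open>\<beta>\<close>, read as a relation between the degrees inside and outside \<open>K\<close>, forces \<open>K\<close> to be a clique and its complement to be stable; the
  equality of the lengths provides a vertex of degree \<open>k\<close> outside \<open>K\<close>, which must be adjacent to all
  of \<open>K\<close>. Hence the chromatic numbers of the graph and its complement are \<open>k + 1\<close> and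
  \<open>|V| - k\<close>, so the graph is automatically an NG-graph, and the last parts show whether the vertices
  of degree \<open>k\<close> form a clique or a stable set (\<open>graph_of_block\<close>). It remains to find a graph for
  each block. This is the realization of a bipartite graph with prescribed degrees, in which majorization is the
  Gale-Ryser condition (\<open>gale_ryser_transfer\<close>, \<open>block_realizable\<close>).
\<close>

section \<open>Majorization between partitions of the same length\<close>

lemma majorizes_iff_prefix_sums:
  assumes "length \<gamma> = k" "length \<delta> = k"
  shows "\<delta> \<succeq> \<gamma> \<longleftrightarrow> (\<forall>m\<le>k. (\<Sum>i<m. \<gamma> ! i) \<le> (\<Sum>i<m. \<delta> ! i))"
  using assms by (auto simp: majorizes_def sum_list_sum_nth atLeast0LessThan min_def)

lemma Dis_k_iff:
  "\<gamma> \<in> Dis_k k n \<longleftrightarrow> length \<gamma> = k \<and> (\<forall>i j. i < j \<longrightarrow> j < k \<longrightarrow> \<gamma> ! j < \<gamma> ! i) \<and>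
     (\<forall>i<k. 0 < \<gamma> ! i) \<and> (\<Sum>i<k. \<gamma> ! i) = n"
  by (auto simp: Dis_k_def Dis_def sorted_wrt_iff_nth_less sum_list_sum_nth atLeast0LessThan
      all_set_conv_all_nth)

lemma Dis_k_subset_Dis: "Dis_k k n \<subseteq> Dis n"
  by (auto simp: Dis_k_def)

lemma Dis_k_gap:
  assumes "\<gamma> \<in> Dis_k k n" "i \<le> j" "j < k"
  shows "\<gamma> ! j + (j - i) \<le> \<gamma> ! i"
  using assms(2,3)
proof (induction j rule: dec_induct)
  case (step j)
  then have "\<gamma> ! Suc j < \<gamma> ! j"
    using assms(1) by (simp add: Dis_k_iff)
  with step show ?case by simp
qed simp

lemma Dis_k_lower:
  assumes "\<gamma> \<in> Dis_k k n" "i < k"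
  shows "k - i \<le> \<gamma> ! i"
proof -
  have "0 < \<gamma> ! (k - 1)"
    using assms by (auto simp: Dis_k_iff)
  with Dis_k_gap[OF assms(1), of i "k - 1"] assms(2) show ?thesis by linarith
qed

lemma sum_staircase: "(\<Sum>i<k. k - i) = (k + 1) choose 2"
proof (induction k)
  case (Suc k)
  have "(\<Sum>i<Suc k. Suc k - i) = Suc k + (\<Sum>i<k. k - i)"
    by (simp add: sum.lessThan_Suc_shift del: sum.lessThan_Suc)
  with Suc show ?case by (simp add: numeral_2_eq_2)
qed simp

text \<open>The sum of the first \<open>k - 1\<close> parts can only be larger in \<open>\<delta>\<close>, and both totals are \<open>n\<close>.\<close>

lemma majorizes_last_part:
  assumes "\<gamma> \<in> Dis_k k n" "\<delta> \<in> Dis_k k n" "\<delta> \<succeq> \<gamma>" "0 < k"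
  shows "\<delta> ! (k - 1) \<le> \<gamma> ! (k - 1)"
proof -
  obtain l where k: "k = Suc l"
    using assms(4) by (cases k) auto
  have "length \<gamma> = k" "length \<delta> = k"
    using assms(1,2) by (auto simp: Dis_k_iff)
  from majorizes_iff_prefix_sums[OF this] assms(3)
  have "(\<Sum>i<l. \<gamma> ! i) \<le> (\<Sum>i<l. \<delta> ! i)"
    by (simp add: k)
  moreover have "(\<Sum>i<Suc l. \<gamma> ! i) = (\<Sum>i<Suc l. \<delta> ! i)"
    using assms(1,2) by (simp add: Dis_k_iff k)
  ultimately show ?thesis by (simp add: k)
qed

section \<open>The extreme partitions\<close>

lemma sum_prefix_suffix:
  fixes f :: "nat \<Rightarrow> nat"
  assumes "m \<le> k"
  shows "(\<Sum>i<m. f i) + (\<Sum>i=m..<k. f i) = (\<Sum>i<k. f i)"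
  using assms by (simp add: sum.atLeastLessThan_concat flip: atLeast0LessThan)

lemma tau'_nth:
  assumes "i < k"
  shows "tau' k n ! i = (if i = 0 then n - (k choose 2) else k - i)"
  using assms by (cases i) (auto simp: tau'_def rev_nth)

lemma tau'_Dis_k:
  assumes "0 < k" "(k + 1) choose 2 \<le> n"
  shows "tau' k n \<in> Dis_k k n"
proof -
  have ch: "(k + 1) choose 2 = k + (k choose 2)"
    by (simp add: numeral_2_eq_2)
  obtain l where l: "k = Suc l"
    using assms(1) by (cases k) auto
  have "(\<Sum>i<k. tau' k n ! i) = tau' k n ! 0 + (\<Sum>i<l. tau' k n ! Suc i)"
    unfolding l by (simp add: sum.lessThan_Suc_shift del: sum.lessThan_Suc)
  also have "\<dots> = (n - (k choose 2)) + (\<Sum>i<l. l - i)"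
    by (simp add: tau'_nth l)
  also have "\<dots> = n"
    using assms(2) ch sum_staircase[of l] by (simp add: l)
  finally show ?thesis
    using assms ch by (auto simp: Dis_k_iff tau'_nth) (simp add: tau'_def)
qed

text \<open>After its first part, \<open>tau'\<close> has the smallest parts that distinctness allows, so all
  its tails have the smallest sum and hence all its prefixes the largest.\<close>

lemma tau'_majorizes:
  assumes "0 < k" "(k + 1) choose 2 \<le> n" "\<gamma> \<in> Dis_k k n"
  shows "tau' k n \<succeq> \<gamma>"
proof -
  have t: "tau' k n \<in> Dis_k k n"
    using assms(1,2) by (rule tau'_Dis_k)
  have "(\<Sum>i<m. \<gamma> ! i) \<le> (\<Sum>i<m. tau' k n ! i)" if "m \<le> k" for m
  proof (cases "m = 0")
    case False
    have "(\<Sum>i=m..<k. tau' k n ! i) \<le> (\<Sum>i=m..<k. \<gamma> ! i)"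
      using False Dis_k_lower[OF assms(3)] by (intro sum_mono) (auto simp: tau'_nth)
    moreover have "(\<Sum>i<k. tau' k n ! i) = (\<Sum>i<k. \<gamma> ! i)"
      using t assms(3) by (simp add: Dis_k_iff)
    ultimately show ?thesis
      using sum_prefix_suffix[OF that, of "(!) \<gamma>"] sum_prefix_suffix[OF that, of "(!) (tau' k n)"]
      by linarith
  qed simp
  then show ?thesis
    using t assms(3) by (subst majorizes_iff_prefix_sums) (auto simp: Dis_k_iff)
qed

lemma tau_nth:
  assumes "i < k"
  shows "tau k n ! i = (n - ((k + 1) choose 2)) div k +
           (if i < (n - ((k + 1) choose 2)) mod k then 1 else 0) + (k - i)"
  using assms by (auto simp: tau_def Let_def simp del: upt_Suc)

lemma tau_Dis_k:
  assumes "0 < k" "(k + 1) choose 2 \<le> n"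
  shows "tau k n \<in> Dis_k k n"
proof -
  define N where "N = n - ((k + 1) choose 2)"
  have "(\<Sum>i<k. if i < N mod k then 1 else 0) = card {i \<in> {..<k}. i < N mod k}"
    by (simp add: sum.If_cases Int_def)
  also have "{i \<in> {..<k}. i < N mod k} = {..<N mod k}"
    using mod_less_divisor[OF assms(1), of N] by auto
  finally have extra: "(\<Sum>i<k. if i < N mod k then 1 else 0) = N mod k"
    by simp
  have "(\<Sum>i<k. tau k n ! i) = (\<Sum>i<k. N div k + (if i < N mod k then 1 else 0) + (k - i))"
    by (intro sum.cong refl) (simp only: tau_nth lessThan_iff N_def)
  also have "\<dots> = k * (N div k) + N mod k + ((k + 1) choose 2)"
    by (simp only: sum.distrib extra sum_staircase) simp
  also have "\<dots> = n"
    using assms(2) by (simp add: N_def)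
  finally show ?thesis
    using assms(1) by (auto simp: Dis_k_iff tau_nth) (simp add: tau_def Let_def)
qed

text \<open>After subtracting the staircase \<open>k, k - 1, \<dots>, 1\<close>, the parts of \<open>tau\<close> are as equal as possible.
  If a prefix of \<open>\<gamma>\<close> had a smaller sum than that of \<open>tau\<close>, then some reduced part of \<open>\<gamma>\<close> would
  be at most the quotient \<open>q\<close>, and so would all later ones; but then \<open>\<gamma>\<close> could not catch up.\<close>

lemma majorizes_tau:
  assumes "0 < k" "(k + 1) choose 2 \<le> n" "\<gamma> \<in> Dis_k k n"
  shows "\<gamma> \<succeq> tau k n"
proof -
  have t: "tau k n \<in> Dis_k k n"
    using assms(1,2) by (rule tau_Dis_k)
  define q where "q = (n - ((k + 1) choose 2)) div k"
  have tb: "q + (k - i) \<le> tau k n ! i" "tau k n ! i \<le> q + 1 + (k - i)" if "i < k" for i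
    using that by (auto simp: tau_nth q_def)
  have "(\<Sum>i<m. tau k n ! i) \<le> (\<Sum>i<m. \<gamma> ! i)" if "m \<le> k" for m
  proof (rule ccontr)
    assume neg: "\<not> ?thesis"
    have "\<exists>i<m. \<gamma> ! i < tau k n ! i"
    proof (rule ccontr)
      assume "\<not> ?thesis"
      then have "(\<Sum>i<m. tau k n ! i) \<le> (\<Sum>i<m. \<gamma> ! i)"
        by (intro sum_mono) force
      with neg show False by simp
    qed
    then obtain i where i: "i < m" "\<gamma> ! i < tau k n ! i" by blast
    have "\<gamma> ! j \<le> tau k n ! j" if "j \<in> {m..<k}" for j
      using Dis_k_gap[OF assms(3), of i j] tb[of i] tb[of j] i that by auto
    then have "(\<Sum>j=m..<k. \<gamma> ! j) \<le> (\<Sum>j=m..<k. tau k n ! j)"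
      by (rule sum_mono)
    moreover have "(\<Sum>i<k. tau k n ! i) = (\<Sum>i<k. \<gamma> ! i)"
      using t assms(3) by (simp add: Dis_k_iff)
    ultimately show False
      using neg sum_prefix_suffix[OF that, of "(!) \<gamma>"] sum_prefix_suffix[OF that, of "(!) (tau k n)"]
      by linarith
  qed
  then show ?thesis
    using t assms(3) by (subst majorizes_iff_prefix_sums) (auto simp: Dis_k_iff)
qed

section \<open>Intervals of blocks\<close>

lemma tau_block_in_S_Block:
  assumes "0 < k" "(k + 1) choose 2 \<le> n"
  shows "(tau k n, tau' k n) \<in> S_Block n"
  using assms tau_Dis_k[OF assms] tau'_Dis_k[OF assms] majorizes_tau[OF assms]
  by (auto simp: S_Block_def Dis_k_def)

lemma Max_blocks_subset_S_Block: "Max_blocks n k \<subseteq> S_Block n"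
  by (auto simp: Max_blocks_def S_Block_def Dis_k_def majorizes_def)

text \<open>Majorization cannot increase the length, so the two bounds force both entries of the block to
  have exactly \<open>k\<close> parts.\<close>

lemma interval_eq:
  assumes "0 < k" "(k + 1) choose 2 \<le> n"
  shows "{X \<in> S_Block n. X \<succeq>\<^sub>B (tau k n, tau' k n) \<and> (\<exists>Y \<in> Max_blocks n k. P Y \<and> Y \<succeq>\<^sub>B X)} =
    {X \<in> A_blocks n k. \<exists>\<gamma> \<in> Dis_k k n. P (\<gamma>, \<gamma>) \<and> \<gamma> \<succeq> fst X \<and> snd X \<succeq> \<gamma>}" (is "?L = ?R")
proof
  show "?L \<subseteq> ?R"
  proof clarsimp
    fix \<alpha> \<beta> Y
    assume X: "(\<alpha>, \<beta>) \<in> S_Block n" and lo: "(\<alpha>, \<beta>) \<succeq>\<^sub>B (tau k n, tau' k n)"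
      and Y: "Y \<in> Max_blocks n k" "P Y" "Y \<succeq>\<^sub>B (\<alpha>, \<beta>)"
    from Y obtain \<gamma> where \<gamma>: "Y = (\<gamma>, \<gamma>)" "\<gamma> \<in> Dis_k k n"
      by (auto simp: Max_blocks_def)
    have D: "\<alpha> \<in> Dis n" "\<beta> \<in> Dis n" "\<gamma> \<in> Dis n" "tau k n \<in> Dis n" "tau' k n \<in> Dis n"
      "length \<gamma> = k" "length (tau k n) = k" "length (tau' k n) = k"
      using X \<gamma>(2) tau_Dis_k[OF assms] tau'_Dis_k[OF assms]
      by (auto simp: S_Block_def Dis_k_def)
    have ge: "\<alpha> \<succeq> tau k n" "tau' k n \<succeq> \<beta>" "\<gamma> \<succeq> \<alpha>" "\<beta> \<succeq> \<gamma>"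
      using lo Y(3) by (auto simp: block_majorizes_def \<gamma>(1))
    have "length \<alpha> = k"
      using majorizes_length[OF D(4,1) ge(1)] majorizes_length[OF D(1,3) ge(3)] D by simp
    moreover have "length \<beta> = k"
      using majorizes_length[OF D(2,5) ge(2)] majorizes_length[OF D(3,2) ge(4)] D by simp
    ultimately show "(\<alpha>, \<beta>) \<in> A_blocks n k \<and>
        (\<exists>\<gamma> \<in> Dis_k k n. P (\<gamma>, \<gamma>) \<and> \<gamma> \<succeq> \<alpha> \<and> \<beta> \<succeq> \<gamma>)"
      using X D Y(2) \<gamma> ge by (auto simp: A_blocks_def Dis_k_def)
  qed
  show "?R \<subseteq> ?L"
    using majorizes_tau[OF assms] tau'_majorizes[OF assms]
    by (fastforce simp: A_blocks_def Max_blocks_def block_majorizes_def)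
qed

text \<open>Two comparable diagonal blocks coincide, so any set of them is an antichain.\<close>

lemma amphora_interval:
  assumes "0 < k" "(k + 1) choose 2 \<le> n"
  shows "amphora (S_Block n) (\<lambda>X Y. Y \<succeq>\<^sub>B X)
    {X \<in> S_Block n. X \<succeq>\<^sub>B (tau k n, tau' k n) \<and> (\<exists>Y \<in> Max_blocks n k. P Y \<and> Y \<succeq>\<^sub>B X)}"
proof -
  let ?A = "{Y \<in> Max_blocks n k. P Y}" and ?x = "(tau k n, tau' k n)"
  have "?A \<subseteq> S_Block n"
    using Max_blocks_subset_S_Block by blast
  moreover have "\<forall>X\<in>?A. \<forall>Y\<in>?A. X \<noteq> Y \<longrightarrow> \<not> Y \<succeq>\<^sub>B X"
    using Dis_k_subset_Dis majorizes_antisym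
    by (fastforce simp: Max_blocks_def block_majorizes_def)
  moreover have "?x \<in> S_Block n"
    using assms by (rule tau_block_in_S_Block)
  moreover have "\<forall>Y\<in>?A. Y \<succeq>\<^sub>B ?x"
    using majorizes_tau[OF assms] tau'_majorizes[OF assms]
    by (auto simp: Max_blocks_def block_majorizes_def)
  ultimately show ?thesis
    unfolding amphora_def by (intro exI[of _ ?A] exI[of _ ?x]) auto
qed

section \<open>Degree sequences and their Durfee square\<close>

lemma degree_seq_eqI:
  assumes "distinct vs" "sorted_wrt (\<ge>) (map (deg E) vs)"
  shows "degree_seq (set vs) E = map (deg E) vs"
proof -
  have "sorted (rev (map (deg E) vs))"
    using assms(2) by (simp only: sorted_wrt_rev)
  then have "sort (map (deg E) vs) = rev (map (deg E) vs)"
    by (intro properties_for_sort) (simp_all flip: mset_map)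
  moreover have "image_mset (deg E) (mset_set (set vs)) = mset (map (deg E) vs)"
    using assms(1) by (simp add: mset_set_set)
  ultimately show ?thesis
    by (simp add: degree_seq_def del: mset_map)
qed

lemma degree_seq_enumeration:
  assumes "finite V"
  obtains vs where "distinct vs" "set vs = V" "sorted_wrt (\<ge>) (map (deg E) vs)"
    "degree_seq V E = map (deg E) vs"
proof -
  obtain xs where xs: "set xs = V" "distinct xs"
    using finite_distinct_list[OF assms] by blast
  define vs where "vs = rev (sort_key (deg E) xs)"
  have "sorted_wrt (\<ge>) (map (deg E) vs)"
    by (simp add: vs_def sorted_wrt_rev flip: rev_map)
  moreover have "distinct vs" "set vs = V"
    using xs by (simp_all add: vs_def)
  ultimately show thesis
    using degree_seq_eqI that by blast
qed

lemma conj_part_map: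
  assumes "distinct vs"
  shows "conj_part (map f vs) j = card {v \<in> set vs. j \<le> f v}"
proof -
  let ?I = "{i \<in> {1..length vs}. j \<le> f (vs ! (i - 1))}"
  have "{v \<in> set vs. j \<le> f v} = (\<lambda>i. vs ! (i - 1)) ` ?I"
  proof (intro equalityI subsetI)
    fix v assume "v \<in> {v \<in> set vs. j \<le> f v}"
    then obtain i where "i < length vs" "vs ! i = v" "j \<le> f v"
      by (auto simp: in_set_conv_nth)
    then show "v \<in> (\<lambda>i. vs ! (i - 1)) ` ?I"
      by (intro image_eqI[of _ _ "Suc i"]) auto
  qed auto
  moreover have "inj_on (\<lambda>i. vs ! (i - 1)) ?I"
  proof (rule inj_onI)
    fix x y assume "x \<in> ?I" "y \<in> ?I" "vs ! (x - 1) = vs ! (y - 1)"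
    with assms have "x - 1 = y - 1" "1 \<le> x" "1 \<le> y"
      by (auto simp: nth_eq_iff_index_eq)
    then show "x = y" by simp
  qed
  ultimately have "card {v \<in> set vs. j \<le> f v} = card ?I"
    by (simp add: card_image)
  also have "?I = {i \<in> {1..length (map f vs)}. j \<le> map f vs ! (i - 1)}"
    by auto
  finally show ?thesis by (simp add: conj_part_def)
qed

lemma decreasing_nth:
  fixes \<pi> :: "nat list"
  assumes "sorted_wrt (\<ge>) \<pi>" "i \<le> j" "j < length \<pi>"
  shows "\<pi> ! j \<le> \<pi> ! i"
  using assms by (cases "i = j") (auto simp: sorted_wrt_iff_nth_less)

lemma conj_part_le:
  assumes "sorted_wrt (\<ge>) \<pi>" "\<pi> ! k < j"
  shows "conj_part \<pi> j \<le> k"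
proof -
  have "i \<le> k" if "i \<le> length \<pi>" "j \<le> \<pi> ! (i - 1)" for i
  proof (rule ccontr)
    assume "\<not> i \<le> k"
    then have "k \<le> i - 1" "i - 1 < length \<pi>"
      using that(1) by linarith+
    from decreasing_nth[OF assms(1) this] that(2) assms(2) show False by linarith
  qed
  then have "conj_part \<pi> j \<le> card {1..k}"
    unfolding conj_part_def by (intro card_mono) auto
  then show ?thesis by simp
qed

lemma conj_part_antimono: "i \<le> j \<Longrightarrow> conj_part \<pi> j \<le> conj_part \<pi> i"
  unfolding conj_part_def by (rule card_mono) auto

lemma filter_upt_eq:
  assumes "k \<le> m" "\<And>i. 1 \<le> i \<Longrightarrow> i \<le> m \<Longrightarrow> P i \<longleftrightarrow> i \<le> k"
  shows "filter P [1..<m + 1] = [1..<k + 1]"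
proof -
  have "[1..<m + 1] = [1..<k + 1] @ [k + 1..<m + 1]"
    using upt_add_eq_append[of 1 "k + 1" "m - k"] assms(1) by simp
  moreover have "filter P [1..<k + 1] = [1..<k + 1]"
    using assms by (auto simp: filter_id_conv simp del: upt_Suc)
  moreover have "filter P [k + 1..<m + 1] = []"
    using assms by (auto simp: filter_empty_conv simp del: upt_Suc)
  ultimately show ?thesis by (simp del: upt_Suc)
qed

text \<open>The index sets in the definitions of \<open>alpha_of\<close> and \<open>beta_of\<close> are initial segments of the
  indices, so they are determined by the lengths of the results.\<close>

lemma filter_upt_down_closed:
  assumes "\<And>i j. 1 \<le> i \<Longrightarrow> i \<le> j \<Longrightarrow> j \<le> m \<Longrightarrow> P j \<Longrightarrow> P i"
    and "1 \<le> i" "i \<le> m"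
  shows "P i \<longleftrightarrow> i \<le> length (filter P [1..<m + 1])"
proof -
  define k where "k = card {i \<in> {1..m}. P i}"
  have down: "{1..i} \<subseteq> {i \<in> {1..m}. P i}" if "1 \<le> i" "i \<le> m" "P i" for i
    using that assms(1) by auto
  have up: "{i \<in> {1..m}. P i} \<subseteq> {1..<i}" if "1 \<le> i" "i \<le> m" "\<not> P i" for i
    using that assms(1)[of i] by (force simp: not_le[symmetric])
  have "P i \<longleftrightarrow> i \<le> k" if "1 \<le> i" "i \<le> m" for i
    using card_mono[OF _ down[OF that]] card_mono[OF _ up[OF that]] that
    by (cases "P i") (auto simp: k_def)
  moreover have "k \<le> m"
  proof -
    have "k \<le> card {1..m}"
      unfolding k_def by (intro card_mono) auto
    then show ?thesis by simp
  qed
  ultimately show ?thesis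
    using filter_upt_eq[of k m P] assms(2,3) by (simp del: upt_Suc)
qed

text \<open>The degree sequences whose \<open>\<alpha>\<close> and \<open>\<beta>\<close> both have \<open>k > 0\<close> parts are those with
  entry \<open>k\<close> at position \<open>k\<close>, counted from zero: then the Ferrers diagram contains a rectangle with
  \<open>k + 1\<close> rows and \<open>k\<close> columns but no square of side \<open>k + 1\<close>.\<close>

lemma durfee_alpha_of:
  assumes "sorted_wrt (\<ge>) \<pi>" "k < length \<pi>" "\<pi> ! k = k"
  shows "alpha_of \<pi> = map (\<lambda>i. \<pi> ! i - i) [0..<k]"
proof -
  note mono = decreasing_nth[OF assms(1)]
  have "filter (\<lambda>i. \<pi> ! (i - 1) \<ge> i) [1..<length \<pi> + 1] = [1..<k + 1]"
  proof (rule filter_upt_eq)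
    fix i assume i: "1 \<le> i" "i \<le> length \<pi>"
    show "i \<le> \<pi> ! (i - 1) \<longleftrightarrow> i \<le> k"
      using mono[of "i - 1" k] mono[of k "i - 1"] assms(2,3) i by fastforce
  qed (use assms in simp)
  also have "\<dots> = map Suc [0..<k]"
    by (simp add: map_Suc_upt)
  finally have filter: "filter (\<lambda>i. \<pi> ! (i - 1) \<ge> i) [1..<length \<pi> + 1] = map Suc [0..<k]" .
  have "i < \<pi> ! i" if "i < k" for i
    using mono[of i k] assms(2,3) that by linarith
  then show ?thesis
    unfolding alpha_of_def filter by (auto simp: Suc_diff_Suc)
qed

lemma durfee_conj_part:
  assumes "sorted_wrt (\<ge>) \<pi>" "k < length \<pi>" "\<pi> ! k = k"
  shows "j \<le> k \<Longrightarrow> k < conj_part \<pi> j" "k < j \<Longrightarrow> conj_part \<pi> j \<le> k"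
proof -
  note mono = decreasing_nth[OF assms(1)]
  show "k < conj_part \<pi> j" if "j \<le> k"
  proof -
    have "j \<le> \<pi> ! (i - 1)" if "i \<le> Suc k" for i
      using mono[of "i - 1" k] assms(2,3) that \<open>j \<le> k\<close> by linarith
    then have "card {1..Suc k} \<le> conj_part \<pi> j"
      unfolding conj_part_def using assms(2) by (intro card_mono) auto
    then show ?thesis by simp
  qed
  show "conj_part \<pi> j \<le> k" if "k < j"
    using conj_part_le[OF assms(1)] assms(3) that by simp
qed

lemma durfee_beta_of:
  assumes "sorted_wrt (\<ge>) \<pi>" "k < length \<pi>" "\<pi> ! k = k"
  shows "beta_of \<pi> = map (\<lambda>j. conj_part \<pi> (j + 1) - (j + 1)) [0..<k]"
proof -
  have "filter (\<lambda>j. conj_part \<pi> j > j) [1..<length \<pi> + 1] = [1..<k + 1]"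
    using durfee_conj_part[OF assms] assms(2)
    by (intro filter_upt_eq) (force simp: not_le[symmetric])+
  also have "\<dots> = map Suc [0..<k]"
    by (simp add: map_Suc_upt)
  finally show ?thesis
    by (simp add: beta_of_def del: upt_Suc)
qed

lemma durfee_of_lengths:
  assumes "sorted_wrt (\<ge>) \<pi>" "length (alpha_of \<pi>) = k" "length (beta_of \<pi>) = k" "0 < k"
  shows "k < length \<pi> \<and> \<pi> ! k = k"
proof -
  note mono = decreasing_nth[OF assms(1)]
  have la: "length (filter (\<lambda>i. \<pi> ! (i - 1) \<ge> i) [1..<length \<pi> + 1]) = k"
    using assms(2) by (simp add: alpha_of_def del: upt_Suc)
  have lb: "length (filter (\<lambda>j. conj_part \<pi> j > j) [1..<length \<pi> + 1]) = k"
    using assms(3) by (simp add: beta_of_def del: upt_Suc)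
  have a: "i \<le> \<pi> ! (i - 1) \<longleftrightarrow> i \<le> k" if "1 \<le> i" "i \<le> length \<pi>" for i
  proof -
    have "i \<le> \<pi> ! (i - 1)" if "i \<le> j" "j \<le> length \<pi>" "j \<le> \<pi> ! (j - 1)" "1 \<le> i" for i j
      using mono[of "i - 1" "j - 1"] that by linarith
    then show ?thesis
      using filter_upt_down_closed[of "length \<pi>" "\<lambda>i. \<pi> ! (i - 1) \<ge> i" i] that
      unfolding la by blast
  qed
  have b: "j < conj_part \<pi> j \<longleftrightarrow> j \<le> k" if "1 \<le> j" "j \<le> length \<pi>" for j
  proof -
    have "i < conj_part \<pi> i" if "i \<le> j" "j < conj_part \<pi> j" for i j
      using conj_part_antimono[of i j \<pi>] that by linarith
    then show ?thesis
      using filter_upt_down_closed[of "length \<pi>" "\<lambda>j. j < conj_part \<pi> j" j] that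
      unfolding lb by blast
  qed
  have "k \<le> length \<pi>"
    using la length_filter_le[of _ "[1..<length \<pi> + 1]"] by (metis add_diff_cancel_right' length_upt)
  then have c: "k < conj_part \<pi> k"
    using b assms(4) by simp
  have "conj_part \<pi> k \<le> card {1..length \<pi>}"
    unfolding conj_part_def by (intro card_mono) auto
  with c have k: "k < length \<pi>" by simp
  have "\<pi> ! k \<le> k"
    using a[of "Suc k"] k by simp
  moreover have "k \<le> \<pi> ! k"
    using conj_part_le[OF assms(1), of k k] c by linarith
  ultimately show ?thesis using k by simp
qed

section \<open>Split graphs\<close>

lemma sum_deg_eq:
  assumes "finite E" "finite S"
  shows "(\<Sum>v\<in>S. deg E v) = (\<Sum>e\<in>E. card (e \<inter> S))"
proof -
  have "(\<Sum>v\<in>S. deg E v) = (\<Sum>v\<in>S. \<Sum>e\<in>E. if v \<in> e then 1 else 0)"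
    using assms by (simp add: deg_def sum.If_cases Int_def)
  also have "\<dots> = (\<Sum>e\<in>E. \<Sum>v\<in>S. if v \<in> e then 1 else 0)"
    by (rule sum.swap)
  also have "\<dots> = (\<Sum>e\<in>E. card (e \<inter> S))"
    using assms by (simp add: sum.If_cases Int_def conj_commute)
  finally show ?thesis .
qed

lemma fin_graph_finite: "fin_graph V E \<Longrightarrow> finite V \<and> finite E"
  unfolding fin_graph_def by (metis finite_imp_finite_nsets finite_subset)

text \<open>Edges between \<open>K\<close> and its complement contribute equally to both degree sums, so their
  difference is twice the number of edges inside \<open>K\<close> minus twice the number of edges outside. This
  can be \<open>k * (k - 1)\<close> only if the former are all pairs and the latter are absent.\<close>

lemma split_of_degree_sums:
  assumes G: "fin_graph V E" and K: "K \<subseteq> V" "card K = k"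
    and eq: "(\<Sum>v\<in>K. deg E v) = k * (k - 1) + (\<Sum>v\<in>V - K. deg E v)"
  shows "clique K E" "indep (V - K) E"
proof -
  have fin: "finite V" "finite E" "finite K"
    using fin_graph_finite[OF G] K finite_subset by auto
  let ?in = "{e \<in> E. e \<subseteq> K}" and ?out = "{e \<in> E. e \<subseteq> V - K}"
  have "card (e \<inter> K) + (if e \<subseteq> V - K then 2 else 0) =
      card (e \<inter> (V - K)) + (if e \<subseteq> K then 2 else 0)" if "e \<in> E" for e
  proof -
    have "e \<in> [V]\<^bsup>2\<^esup>"
      using G that by (auto simp: fin_graph_def)
    then obtain x y where "e = {x, y}" "x \<in> V" "y \<in> V" "x \<noteq> y"
      by (rule nsets2_E)
    then show ?thesis
      by (cases "x \<in> K"; cases "y \<in> K") auto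
  qed
  then have "(\<Sum>e\<in>E. card (e \<inter> K) + (if e \<subseteq> V - K then 2 else 0)) =
      (\<Sum>e\<in>E. card (e \<inter> (V - K)) + (if e \<subseteq> K then 2 else 0))"
    by (rule sum.cong[OF refl])
  then have "(\<Sum>v\<in>K. deg E v) + 2 * card ?out = (\<Sum>v\<in>V - K. deg E v) + 2 * card ?in"
    using fin by (simp add: sum_deg_eq sum.distrib sum.If_cases Int_def mult.commute)
  then have count: "k * (k - 1) + 2 * card ?out = 2 * card ?in"
    using eq by simp
  have sub: "?in \<subseteq> [K]\<^bsup>2\<^esup>"
    using G by (auto simp: fin_graph_def nsets_def)
  have "[K]\<^bsup>2\<^esup> = {N. N \<subseteq> K \<and> card N = 2}"
    using fin(3) by (auto simp: nsets_def intro: finite_subset)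
  then have c2: "card ([K]\<^bsup>2\<^esup>) = k choose 2"
    using fin(3) K(2) by (simp add: n_subsets)
  have "2 * (k choose 2) = k * (k - 1)"
    by (cases k) (simp_all add: choose_two dvd_mult_div_cancel)
  moreover have "card ?in \<le> k choose 2"
    using card_mono[OF _ sub] c2 fin(3) by (simp add: finite_imp_finite_nsets)
  ultimately have "card ?in = card ([K]\<^bsup>2\<^esup>)" "card ?out = 0"
    using count c2 by linarith+
  then have "?in = [K]\<^bsup>2\<^esup>" "?out = {}"
    using card_subset_eq[OF _ sub] fin by (auto simp: finite_imp_finite_nsets)
  then show "clique K E" "indep (V - K) E"
    by (auto simp: clique_def indep_def)
qed

lemma clique_le_colors:
  assumes "colorable V E m" "K \<subseteq> V" "clique K E"
  shows "card K \<le> m"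
proof -
  obtain c :: "'a \<Rightarrow> nat" where c: "\<forall>v\<in>V. c v < m" "\<forall>u\<in>V. \<forall>v\<in>V. {u, v} \<in> E \<longrightarrow> c u \<noteq> c v"
    using assms(1) by (auto simp: colorable_def)
  have "inj_on c K"
    using c(2) assms(2,3) by (auto simp: inj_on_def clique_def) (metis subsetD)
  moreover have "c ` K \<subseteq> {..<m}"
    using c(1) assms(2) by auto
  ultimately show ?thesis
    using card_inj_on_le[of c K "{..<m}"] by simp
qed

lemma chromatic_number_eqI:
  assumes "colorable V E m" "K \<subseteq> V" "clique K E" "card K = m"
  shows "chromatic_number V E = m"
  unfolding chromatic_number_def
  using assms clique_le_colors by (intro Least_equality) blast+

text \<open>Adding \<open>v\<close> to \<open>K\<close> gives a clique of \<open>k + 1\<close> vertices, and the stable set needs only one colour.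
  In the complement the roles are exchanged, and there \<open>K\<close> can take the colour of \<open>v\<close>.\<close>

lemma NG_graph_split:
  assumes G: "fin_graph V E" "no_isolated V E" and K: "K \<subseteq> V" "card K = k"
    and split: "clique K E" "indep (V - K) E"
    and v: "v \<in> V - K" "\<forall>u\<in>K. {u, v} \<in> E"
  shows "chromatic_number V E = k + 1" "NG_graph V E"
proof -
  have fin: "finite V" "finite K"
    using G K finite_subset by (auto simp: fin_graph_def)
  have loop: "{u, u} \<notin> E" for u
    using G(1) by (auto simp: fin_graph_def nsets_def)
  obtain f where f: "bij_betw f K {..<k}"
    using ex_bij_betw_finite_nat[OF fin(2)] K(2) by (auto simp: atLeast0LessThan)
  have "colorable V E (k + 1)"
    unfolding colorable_def
  proof (intro exI[of _ "\<lambda>u. if u \<in> K then f u else k"] conjI ballI impI)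
    fix u w assume uw: "u \<in> V" "w \<in> V" "{u, w} \<in> E"
    then have "u \<noteq> w" using loop by auto
    then show "(if u \<in> K then f u else k) \<noteq> (if w \<in> K then f w else k)"
      using uw f split(2) bij_betwE[OF f]
      by (auto simp: bij_betw_def indep_def inj_on_eq_iff)
  qed (use bij_betwE[OF f] in \<open>auto simp: less_Suc_eq\<close>)
  moreover have "clique (insert v K) E"
    using split(1) v by (auto simp: clique_def insert_commute)
  moreover have "insert v K \<subseteq> V" "card (insert v K) = k + 1"
    using v K fin by auto
  ultimately show chi: "chromatic_number V E = k + 1"
    by (intro chromatic_number_eqI[of V E "k + 1" "insert v K"])
  let ?R = "V - K" and ?E = "compl_edges V E"
  have cR: "card ?R = card V - k"
    using K fin by (simp add: card_Diff_subset)
  obtain g where g: "bij_betw g ?R {..<card V - k}"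
    using ex_bij_betw_finite_nat[of ?R] fin cR by (auto simp: atLeast0LessThan)
  have "colorable V ?E (card V - k)"
    unfolding colorable_def
  proof (intro exI[of _ "\<lambda>u. if u \<in> K then g v else g u"] conjI ballI impI)
    fix u w assume uw: "u \<in> V" "w \<in> V" "{u, w} \<in> ?E"
    then have "u \<noteq> w" "{u, w} \<notin> E" "{w, u} \<notin> E"
      by (auto simp: compl_edges_def insert_commute)
    then show "(if u \<in> K then g v else g u) \<noteq> (if w \<in> K then g v else g w)"
      using uw g split(1) v by (auto simp: bij_betw_def clique_def inj_on_eq_iff)
  qed (use bij_betwE[OF g] v in auto)
  moreover have "clique ?R ?E"
    using split(2) by (auto simp: clique_def indep_def compl_edges_def)
  ultimately have "chromatic_number V ?E = card V - k"
    using cR by (intro chromatic_number_eqI) auto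
  moreover have "k \<le> card V"
    using card_mono[OF fin(1) K(1)] K(2) by simp
  ultimately show "NG_graph V E"
    using G chi by (simp add: NG_graph_def)
qed

section \<open>The graphs of an equal-length block\<close>

lemma deg_eq_card_neighbours:
  assumes "fin_graph V E"
  shows "deg E v = card {u. {u, v} \<in> E}"
proof -
  have "{e \<in> E. v \<in> e} = (\<lambda>u. {u, v}) ` {u. {u, v} \<in> E}"
  proof (intro equalityI subsetI)
    fix e assume e: "e \<in> {e \<in> E. v \<in> e}"
    then have "e \<in> [V]\<^bsup>2\<^esup>"
      using assms by (auto simp: fin_graph_def)
    then obtain x y where "e = {x, y}"
      by (rule nsets2_E)
    with e show "e \<in> (\<lambda>u. {u, v}) ` {u. {u, v} \<in> E}"
      by (auto simp: insert_commute)
  qed auto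
  moreover have "inj_on (\<lambda>u. {u, v}) {u. {u, v} \<in> E}"
    by (auto simp: inj_on_def doubleton_eq_iff)
  ultimately show ?thesis
    by (simp add: deg_def card_image)
qed

text \<open>The sum of \<open>\<alpha>\<close> determines the degree sum over the \<open>k\<close> vertices \<open>K\<close> of largest degree,
  and the sum of \<open>\<beta>\<close>, which counts the same diagram by columns, determines the degree sum over the
  other vertices. Since both sums are \<open>n\<close>, the graph is split. Vertices outside \<open>K\<close> of degree
  \<open>k\<close> are pairwise non-adjacent and joined to all of \<open>K\<close>, and there is at least one of them. So
  the vertices of degree \<open>k\<close> form a clique if and only if there is only one outside \<open>K\<close>, which is
  \<open>\<beta>\<^sub>k = 1\<close>, and a stable set if and only if there is none inside \<open>K\<close>, which is
  \<open>\<alpha>\<^sub>k \<ge> 2\<close>.\<close>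

lemma graph_of_block:
  fixes V :: "'a set"
  assumes G: "fin_graph V E" "no_isolated V E" and k: "0 < k"
    and X: "(alpha_of (degree_seq V E), beta_of (degree_seq V E)) \<in> A_blocks n k"
  shows "NG_graph V E"
    and "clique (A_vertices V E) E \<longleftrightarrow> beta_of (degree_seq V E) ! (k - 1) = 1"
    and "indep (A_vertices V E) E \<longleftrightarrow> 2 \<le> alpha_of (degree_seq V E) ! (k - 1)"
proof -
  have fin: "finite V"
    using fin_graph_finite[OF G(1)] by simp
  obtain vs where vs: "distinct vs" "set vs = V" "sorted_wrt (\<ge>) (map (deg E) vs)"
    "degree_seq V E = map (deg E) vs"
    using degree_seq_enumeration[OF fin] by blast
  define \<pi> where "\<pi> = map (deg E) vs"
  have len: "length (alpha_of \<pi>) = k" "length (beta_of \<pi>) = k"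
    and sums: "(\<Sum>i<k. alpha_of \<pi> ! i) = n" "(\<Sum>i<k. beta_of \<pi> ! i) = n"
    using X by (auto simp: A_blocks_def vs(4) \<pi>_def Dis_k_iff)
  have D: "sorted_wrt (\<ge>) \<pi>" "k < length \<pi>" "\<pi> ! k = k"
    using durfee_of_lengths[OF _ len k] vs(3) by (auto simp: \<pi>_def)
  note mono = decreasing_nth[OF D(1)]
  have nth: "\<pi> ! i = deg E (vs ! i)" if "i < length vs" for i
    using that by (simp add: \<pi>_def)
  have lvs: "length \<pi> = length vs"
    by (simp add: \<pi>_def)
  define K where "K = (!) vs ` {..<k}"
  have inj: "inj_on ((!) vs) {..<k}"
    using vs(1) D(2) by (auto simp: inj_on_def \<pi>_def nth_eq_iff_index_eq)
  have K: "K \<subseteq> V" "card K = k"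
    using D(2) lvs vs(2) card_image[OF inj] by (auto simp: K_def)
  have finK: "finite K"
    by (simp add: K_def)
  have degK: "k \<le> deg E u" if "u \<in> K" for u
    using that D mono[of _ k] nth lvs by (force simp: K_def)
  have degR: "deg E u \<le> k" if "u \<in> V - K" for u
  proof -
    obtain i where i: "i < length vs" "u = vs ! i"
      using \<open>u \<in> V - K\<close> vs(2) by (auto simp: in_set_conv_nth)
    with that have "\<not> i < k"
      by (auto simp: K_def)
    then show ?thesis
      using mono[of k i] D i nth lvs by auto
  qed
  define v where "v = vs ! k"
  have v: "v \<in> V - K" "deg E v = k"
    using D(2,3) lvs nth[of k] vs(1,2) by (auto simp: v_def K_def nth_eq_iff_index_eq)
  have \<alpha>: "alpha_of \<pi> ! i = \<pi> ! i - i" if "i < k" for i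
    using durfee_alpha_of[OF D] that by simp
  have \<beta>: "beta_of \<pi> ! i = card {u \<in> V. i + 1 \<le> deg E u} - (i + 1)" if "i < k" for i
    using durfee_beta_of[OF D] conj_part_map[OF vs(1), of "deg E"] that
    by (simp add: \<pi>_def vs(2))
  have big: "k < card {u \<in> V. j \<le> deg E u}" if "j \<le> k" for j
    using durfee_conj_part(1)[OF D that] conj_part_map[OF vs(1), of "deg E"]
    by (simp add: \<pi>_def vs(2))

  \<comment> \<open>The degree sum inside \<open>K\<close>, by the rows of the diagram.\<close>
  have "(\<Sum>v\<in>K. deg E v) = (\<Sum>i<k. \<pi> ! i)"
    using D(2) lvs by (simp add: K_def sum.reindex[OF inj] nth)
  also have "\<dots> = (\<Sum>i<k. alpha_of \<pi> ! i + i)"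
  proof (rule sum.cong[OF refl])
    fix i assume "i \<in> {..<k}"
    then show "\<pi> ! i = alpha_of \<pi> ! i + i"
      using mono[of i k] D(2,3) by (simp add: \<alpha>)
  qed
  finally have sumK: "(\<Sum>v\<in>K. deg E v) = n + (\<Sum>i<k. i)"
    by (simp add: sum.distrib sums)
  \<comment> \<open>The first \<open>k\<close> columns contain \<open>k\<close> cells of each row of \<open>K\<close> and all cells of the others.\<close>
  have "(\<Sum>i<k. card {u \<in> V. i + 1 \<le> deg E u}) = (\<Sum>i<k. \<Sum>u\<in>V. if i < deg E u then 1 else 0)"
    using fin by (simp add: sum.If_cases Int_def Suc_le_eq)
  also have "\<dots> = (\<Sum>u\<in>V. \<Sum>i<k. if i < deg E u then 1 else 0)"
    by (rule sum.swap)
  also have "\<dots> = (\<Sum>u\<in>V. min k (deg E u))"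
  proof (rule sum.cong[OF refl])
    fix u
    have "{i. i < k \<and> i < deg E u} = {..<min k (deg E u)}" by auto
    then show "(\<Sum>i<k. if i < deg E u then 1 else 0) = min k (deg E u)"
      by (simp add: sum.If_cases Int_def)
  qed
  also have "\<dots> = (\<Sum>u\<in>K. min k (deg E u)) + (\<Sum>u\<in>V - K. min k (deg E u))"
    using sum.subset_diff[OF K(1) fin, of "\<lambda>u. min k (deg E u)"] by simp
  also have "\<dots> = k * k + (\<Sum>u\<in>V - K. deg E u)"
    using degK degR K(2) by (simp add: min_absorb1 min_absorb2)
  finally have "k * k + (\<Sum>u\<in>V - K. deg E u) = (\<Sum>i<k. card {u \<in> V. i + 1 \<le> deg E u})" ..
  also have "\<dots> = (\<Sum>i<k. beta_of \<pi> ! i + (i + 1))"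
  proof (rule sum.cong[OF refl])
    fix i assume "i \<in> {..<k}"
    then show "card {u \<in> V. i + 1 \<le> deg E u} = beta_of \<pi> ! i + (i + 1)"
      using big[of "i + 1"] \<beta>[of i] by simp
  qed
  finally have sumR: "k * k + (\<Sum>u\<in>V - K. deg E u) = n + (\<Sum>i<k. i) + k"
    by (simp only: sum.distrib sums) simp
  have "k * k = k * (k - 1) + k"
    using k by (cases k) simp_all
  then have "(\<Sum>v\<in>K. deg E v) = k * (k - 1) + (\<Sum>v\<in>V - K. deg E v)"
    using sumK sumR by linarith
  note split = split_of_degree_sums[OF G(1) K this]

  have full: "{u. {u, w} \<in> E} = K" if w: "w \<in> V - K" "deg E w = k" for w
  proof -
    have "{u. {u, w} \<in> E} \<subseteq> K"
    proof
      fix u assume u: "u \<in> {u. {u, w} \<in> E}"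
      then have "{u, w} \<in> [V]\<^bsup>2\<^esup>"
        using G(1) unfolding fin_graph_def by blast
      then have "u \<in> V" "u \<noteq> w"
        unfolding doubleton_in_nsets_2 by simp_all
      with u w split(2) show "u \<in> K"
        by (auto simp: indep_def)
    qed
    then show ?thesis
      using deg_eq_card_neighbours[OF G(1), of w] w(2) K(2) finK
      by (intro card_subset_eq) auto
  qed
  have vK: "\<forall>u\<in>K. {u, v} \<in> E"
    using full[OF v] by auto
  note NG = NG_graph_split[OF G K split v(1) vK]
  show "NG_graph V E" by (rule NG(2))
  have A: "A_vertices V E = {u \<in> V. deg E u = k}"
    by (simp add: A_vertices_def NG(1))
  have ds: "degree_seq V E = \<pi>"
    by (simp add: vs(4) \<pi>_def)
  let ?B = "{u \<in> V - K. deg E u = k}"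

  have "{u \<in> V. k \<le> deg E u} = K \<union> ?B"
    using degK degR K(1) by (auto intro: le_antisym)
  then have "card {u \<in> V. k \<le> deg E u} = k + card ?B"
    using finK fin K(2) by (simp add: card_Un_disjoint disjoint_iff)
  then have bl: "beta_of \<pi> ! (k - 1) = card ?B"
    using \<beta>[of "k - 1"] k by simp
  have "clique (A_vertices V E) E \<longleftrightarrow> ?B = {v}"
  proof
    assume cl: "clique (A_vertices V E) E"
    have "u = v" if "u \<in> ?B" for u
      using cl split(2) v that by (auto simp: clique_def indep_def A)
    with v show "?B = {v}" by auto
  next
    assume "?B = {v}"
    then have "A_vertices V E \<subseteq> insert v K"
      by (auto simp: A)
    moreover have "clique (insert v K) E"
      using split(1) vK by (auto simp: clique_def insert_commute)
    ultimately show "clique (A_vertices V E) E"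
      by (auto simp: clique_def)
  qed
  also have "\<dots> \<longleftrightarrow> card ?B = 1"
  proof -
    have single: "A = {v} \<longleftrightarrow> card A = 1" if "v \<in> A" for A
      using that by (auto simp: card_1_singleton_iff)
    show ?thesis
      by (rule single) (use v in simp)
  qed
  finally show "clique (A_vertices V E) E \<longleftrightarrow> beta_of (degree_seq V E) ! (k - 1) = 1"
    by (simp only: ds bl)

  have al: "2 \<le> alpha_of \<pi> ! (k - 1) \<longleftrightarrow> k < \<pi> ! (k - 1)"
    using \<alpha>[of "k - 1"] k by auto
  have "indep (A_vertices V E) E \<longleftrightarrow> (\<forall>u\<in>K. k < deg E u)"
  proof
    assume ind: "indep (A_vertices V E) E"
    show "\<forall>u\<in>K. k < deg E u"
    proof (rule ballI, rule ccontr)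
      fix u assume u: "u \<in> K" "\<not> k < deg E u"
      then have "u \<in> A_vertices V E" "v \<in> A_vertices V E" "u \<noteq> v"
        using degK[of u] K(1) v by (auto simp: A)
      with ind vK u(1) show False
        by (auto simp: indep_def)
    qed
  next
    assume "\<forall>u\<in>K. k < deg E u"
    then have "A_vertices V E \<subseteq> V - K"
      by (auto simp: A)
    with split(2) show "indep (A_vertices V E) E"
      by (auto simp: indep_def)
  qed
  also have "\<dots> \<longleftrightarrow> k < \<pi> ! (k - 1)"
  proof
    assume "\<forall>u\<in>K. k < deg E u"
    then show "k < \<pi> ! (k - 1)"
      using k D(2) lvs nth[of "k - 1"] by (auto simp: K_def)
  next
    assume *: "k < \<pi> ! (k - 1)"
    have "k < deg E (vs ! i)" if "i < k" for i
      using * mono[of i "k - 1"] nth[of i] D(2) lvs that by linarith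
    then show "\<forall>u\<in>K. k < deg E u"
      by (auto simp: K_def)
  qed
  finally show "indep (A_vertices V E) E \<longleftrightarrow> 2 \<le> alpha_of (degree_seq V E) ! (k - 1)"
    by (simp only: ds al)
qed

section \<open>Realizing a block by a graph\<close>

text \<open>The sets \<open>S i\<close> are the rows of a zero-one matrix. If their sizes majorize \<open>a\<close> but differ from
  it, then the first wrong row \<open>i\<close> is too large, and some later row is too small; let \<open>j\<close> be the first
  of these. As \<open>a\<close> is decreasing, row \<open>i\<close> is larger than row \<open>j\<close>, so some element can be moved
  from the former to the latter. This keeps the column sums. The prefix sums drop by one exactly
  for \<open>i < m \<le> j\<close>, where they exceed those of \<open>a\<close>; so majorization persists and their total is a
  termination measure.\<close>

lemma gale_ryser_transfer:
  fixes S :: "nat \<Rightarrow> 'a set" and a :: "nat \<Rightarrow> nat"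
  assumes "\<And>i j. i \<le> j \<Longrightarrow> j < k \<Longrightarrow> a j \<le> a i"
    and "\<And>i. i < k \<Longrightarrow> finite (S i)"
    and "\<And>m. m \<le> k \<Longrightarrow> (\<Sum>i<m. a i) \<le> (\<Sum>i<m. card (S i))"
    and "(\<Sum>i<k. a i) = (\<Sum>i<k. card (S i))"
  shows "\<exists>T. (\<forall>i<k. finite (T i) \<and> card (T i) = a i) \<and>
    (\<forall>x. card {i. i < k \<and> x \<in> T i} = card {i. i < k \<and> x \<in> S i})"
  using assms(2-4)
proof (induction "\<Sum>m\<le>k. \<Sum>i<m. card (S i)" arbitrary: S rule: less_induct)
  case less
  note finS = less.prems(1) and maj = less.prems(2) and tot = less.prems(3)
  show ?case
  proof (cases "\<forall>i<k. card (S i) = a i")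
    case True
    with finS show ?thesis by (intro exI[of _ S]) auto
  next
    case False
    define i where "i = (LEAST i. i < k \<and> card (S i) \<noteq> a i)"
    have i: "i < k" "card (S i) \<noteq> a i"
      using False LeastI_ex[of "\<lambda>i. i < k \<and> card (S i) \<noteq> a i"] by (auto simp: i_def)
    have before: "card (S l) = a l" if "l < i" for l
      using not_less_Least[of l "\<lambda>i. i < k \<and> card (S i) \<noteq> a i"] that i(1) by (auto simp: i_def)
    have "(\<Sum>l<i. card (S l)) = (\<Sum>l<i. a l)"
      using before by simp
    with maj[of "Suc i"] i have ai: "a i < card (S i)"
      by simp
    have "\<exists>j. i < j \<and> j < k \<and> card (S j) < a j"
    proof (rule ccontr)
      assume "\<not> ?thesis"
      then have "\<forall>l\<in>{..<k}. a l \<le> card (S l)"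
        using before ai by (metis lessThan_iff linorder_neqE_nat not_less order.order_iff_strict)
      with ai i(1) have "(\<Sum>l<k. a l) < (\<Sum>l<k. card (S l))"
        by (intro sum_strict_mono_ex1) auto
      with tot show False by simp
    qed
    define j where "j = (LEAST j. i < j \<and> j < k \<and> card (S j) < a j)"
    have j: "i < j" "j < k" "card (S j) < a j"
      using LeastI_ex[OF \<open>\<exists>j. i < j \<and> j < k \<and> card (S j) < a j\<close>] by (auto simp: j_def)
    have between: "a l \<le> card (S l)" if "l < j" for l
    proof (cases "i < l")
      case True
      then show ?thesis
        using not_less_Least[of l "\<lambda>j. i < j \<and> j < k \<and> card (S j) < a j"] that j(2)
        by (auto simp: j_def)
    next
      case False
      then show ?thesis
        using before[of l] ai by (cases "l = i") auto
    qed
    have "card (S j) < card (S i)"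
      using assms(1)[of i j] ai j by linarith
    then have "\<not> S i \<subseteq> S j"
      using card_mono[of "S j" "S i"] finS j(2) by auto
    then obtain x where x: "x \<in> S i" "x \<notin> S j" by blast
    define T where "T = S(i := S i - {x}, j := insert x (S j))"
    have ij: "i \<noteq> j" using j by simp
    have cT: "card (T l) + (if l = i then 1 else 0) = card (S l) + (if l = j then 1 else 0)"
      if "l < k" for l
    proof -
      have "card (S i - {x}) + 1 = card (S i)"
        using x finS[OF i(1)] by (metis Suc_eq_plus1 card_Suc_Diff1)
      then show ?thesis
        using x finS[OF j(2)] ij by (auto simp: T_def)
    qed
    have pre: "(\<Sum>l<m. card (T l)) + (if i < m \<and> m \<le> j then 1 else 0) = (\<Sum>l<m. card (S l))"
      if "m \<le> k" for m
    proof -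
      have "(\<Sum>l<m. card (T l) + (if l = i then 1 else 0)) =
          (\<Sum>l<m. card (S l) + (if l = j then 1 else 0))"
        using that by (intro sum.cong[OF refl] cT) auto
      then show ?thesis
        using j(1) by (auto simp: sum.distrib split: if_splits)
    qed
    have finT: "finite (T l)" if "l < k" for l
      using finS that i(1) j(2) by (auto simp: T_def)
    have majT: "(\<Sum>l<m. a l) \<le> (\<Sum>l<m. card (T l))" if "m \<le> k" for m
    proof (cases "i < m \<and> m \<le> j")
      case True
      then have "(\<Sum>l<m. a l) < (\<Sum>l<m. card (S l))"
        using between ai by (intro sum_strict_mono_ex1) auto
      with pre[OF that] True show ?thesis by simp
    next
      case False
      then show ?thesis
        using pre[OF that] maj[OF that] by auto
    qed
    have totT: "(\<Sum>l<k. a l) = (\<Sum>l<k. card (T l))"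
      using pre[of k] tot j(2) by simp
    have "(\<Sum>l<j. card (T l)) < (\<Sum>l<j. card (S l))"
      using pre[of j] j by simp
    moreover have "(\<Sum>l<m. card (T l)) \<le> (\<Sum>l<m. card (S l))" if "m \<le> k" for m
      using pre[OF that] by simp
    ultimately have "(\<Sum>m\<le>k. \<Sum>l<m. card (T l)) < (\<Sum>m\<le>k. \<Sum>l<m. card (S l))"
      using j(2) by (intro sum_strict_mono_ex1) (auto intro!: bexI[of _ j])
    from less.hyps[OF this finT majT totT] obtain U where
      U: "\<forall>i<k. finite (U i) \<and> card (U i) = a i"
        "\<forall>y. card {i. i < k \<and> y \<in> U i} = card {i. i < k \<and> y \<in> T i}"
      by blast
    have "card {l. l < k \<and> y \<in> T l} = card {l. l < k \<and> y \<in> S l}" for y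
    proof (cases "y = x")
      case True
      let ?C = "{l. l < k \<and> x \<in> S l}"
      have "{l. l < k \<and> x \<in> T l} = insert j (?C - {i})"
        using x i(1) j(2) ij by (auto simp: T_def)
      moreover have "i \<in> ?C" "j \<notin> ?C - {i}" "finite ?C"
        using x i(1) by auto
      ultimately have "card {l. l < k \<and> x \<in> T l} = card ?C"
        by (metis card_Suc_Diff1 card_insert_disjoint finite_Diff)
      with True show ?thesis by simp
    next
      case False
      then have "y \<in> T l \<longleftrightarrow> y \<in> S l" for l
        by (auto simp: T_def)
      then show ?thesis by simp
    qed
    with U show ?thesis by auto
  qed
qed

text \<open>The graph has a clique on \<open>{..<k}\<close>, a stable set on \<open>k, k + 1, \<dots>\<close>, and a bipartite graph
  between them with row sums \<open>a\<close> and column sums conjugate to \<open>b\<close>. Here \<open>a\<close> and \<open>b\<close> are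
  \<open>\<alpha>\<close> and \<open>\<beta>\<close> diminished by the staircase \<open>k - 1, \<dots>, 1, 0\<close>, which preserves the
  majorization and leaves them weakly decreasing and positive. The Ferrers diagram of \<open>b\<close> has the
  required column sums and transfers lead from it to row sums \<open>a\<close>.\<close>

lemma block_realizable:
  assumes X: "(\<alpha>, \<beta>) \<in> A_blocks n k" and k: "0 < k"
  obtains V :: "nat set" and E where "fin_graph V E" "no_isolated V E"
    "alpha_of (degree_seq V E) = \<alpha>" "beta_of (degree_seq V E) = \<beta>"
proof -
  have ab: "\<alpha> \<in> Dis_k k n" "\<beta> \<in> Dis_k k n" "\<beta> \<succeq> \<alpha>"
    using X by (auto simp: A_blocks_def S_Block_def)
  have len: "length \<alpha> = k" "length \<beta> = k"
    using ab by (auto simp: Dis_k_iff)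
  define a b where "a = (\<lambda>i. \<alpha> ! i + (i + 1) - k)" and "b = (\<lambda>i. \<beta> ! i + (i + 1) - k)"
  have a: "a i + k = \<alpha> ! i + (i + 1)" "0 < a i" if "i < k" for i
    using Dis_k_lower[OF ab(1) that] that by (auto simp: a_def)
  have b: "b i + k = \<beta> ! i + (i + 1)" "0 < b i" if "i < k" for i
    using Dis_k_lower[OF ab(2) that] that by (auto simp: b_def)
  have a_mono: "a j \<le> a i" if "i \<le> j" "j < k" for i j
    using Dis_k_gap[OF ab(1) that] that by (auto simp: a_def)
  have b_mono: "b j \<le> b i" if "i \<le> j" "j < k" for i j
    using Dis_k_gap[OF ab(2) that] that by (auto simp: b_def)
  have sa: "(\<Sum>i<m. a i) + m * k = (\<Sum>i<m. \<alpha> ! i) + (\<Sum>i<m. i + 1)" if "m \<le> k" for m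
  proof -
    have "(\<Sum>i<m. a i + k) = (\<Sum>i<m. \<alpha> ! i + (i + 1))"
      using a(1) that by (intro sum.cong) auto
    then show ?thesis by (simp only: sum.distrib) simp
  qed
  have sb: "(\<Sum>i<m. b i) + m * k = (\<Sum>i<m. \<beta> ! i) + (\<Sum>i<m. i + 1)" if "m \<le> k" for m
  proof -
    have "(\<Sum>i<m. b i + k) = (\<Sum>i<m. \<beta> ! i + (i + 1))"
      using b(1) that by (intro sum.cong) auto
    then show ?thesis by (simp only: sum.distrib) simp
  qed
  have "(\<Sum>i<m. a i) \<le> (\<Sum>i<m. card {..<b i})" if "m \<le> k" for m
  proof -
    have "(\<Sum>i<m. \<alpha> ! i) \<le> (\<Sum>i<m. \<beta> ! i)"
      using ab(3) majorizes_iff_prefix_sums[OF len] that by simp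
    then show ?thesis
      using sa[OF that] sb[OF that] by simp
  qed
  moreover have "(\<Sum>i<k. a i) = (\<Sum>i<k. card {..<b i})"
    using sa[of k] sb[of k] ab(1,2) by (simp add: Dis_k_iff)
  ultimately obtain T :: "nat \<Rightarrow> nat set" where
    T: "\<And>i. i < k \<Longrightarrow> finite (T i) \<and> card (T i) = a i"
      "\<And>x. card {i. i < k \<and> x \<in> T i} = card {i. i < k \<and> x \<in> {..<b i}}"
    using gale_ryser_transfer[of k a "\<lambda>i. {..<b i}"] a_mono by blast
  \<comment> \<open>The conjugate of \<open>b\<close>, and hence the degree of the vertex \<open>k + x\<close> below.\<close>
  define h where "h x = card {i. i < k \<and> x < b i}" for x
  have T_sub: "x < b 0" if "i < k" "x \<in> T i" for i x
  proof (rule ccontr)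
    assume "\<not> x < b 0"
    then have "\<not> x < b l" if "l < k" for l
      using b_mono[of 0 l] that by simp
    then have "{i. i < k \<and> x \<in> {..<b i}} = {}"
      by auto
    then have "card {i. i < k \<and> x \<in> T i} = 0"
      using T(2)[of x] by simp
    with that show False by auto
  qed
  have h_gt: "j < h x \<longleftrightarrow> x < b j" if "j < k" for j x
  proof
    assume "j < h x"
    show "x < b j"
    proof (rule ccontr)
      assume "\<not> x < b j"
      then have "{i. i < k \<and> x < b i} \<subseteq> {..<j}"
        using b_mono[of j] by (force simp: not_less not_le[symmetric])
      then have "h x \<le> card {..<j}"
        unfolding h_def by (intro card_mono) auto
      with \<open>j < h x\<close> show False by simp
    qed
  next
    assume "x < b j"
    then have "{..j} \<subseteq> {i. i < k \<and> x < b i}"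
      using b_mono[of _ j] that by (auto intro: order.strict_trans2)
    then have "card {..j} \<le> h x"
      unfolding h_def by (intro card_mono) auto
    then show "j < h x" by simp
  qed
  have h_le: "h x \<le> k" for x
    using card_mono[of "{..<k}" "{i. i < k \<and> x < b i}"] by (auto simp: h_def)
  have h_mono: "h y \<le> h x" if "x \<le> y" for x y
    unfolding h_def using that by (intro card_mono) auto

  define V where "V = {..<k + b 0}"
  define E where "E = {{i, j} | i j. i < j \<and> j < k} \<union> {{i, k + x} | i x. i < k \<and> x \<in> T i}"
  have G: "fin_graph V E"
    using T_sub by (auto simp: fin_graph_def V_def E_def)
  have nK: "{u. {u, i} \<in> E} = ({..<k} - {i}) \<union> (+) k ` T i" if "i < k" for i
    using that by (auto simp: E_def doubleton_eq_iff) (metis linorder_neqE_nat)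
  have nR: "{u. {u, k + x} \<in> E} = {i. i < k \<and> x \<in> T i}" for x
    by (auto simp: E_def doubleton_eq_iff)
  have degK: "deg E i = \<alpha> ! i + i" if "i < k" for i
  proof -
    have "card (({..<k} - {i}) \<union> (+) k ` T i) = (k - 1) + a i"
      using T(1)[OF that] that by (subst card_Un_disjoint) (auto simp: card_image)
    then show ?thesis
      using deg_eq_card_neighbours[OF G, of i] nK[OF that] a(1)[OF that] that by simp
  qed
  have degR: "deg E (k + x) = h x" for x
    using deg_eq_card_neighbours[OF G, of "k + x"] nR[of x] T(2)[of x] by (simp add: h_def)
  have degK_ge: "k \<le> deg E i" if "i < k" for i
    using degK[OF that] a[OF that] by linarith
  \<comment> \<open>The numbering of the vertices lists them by decreasing degree, so it yields the degree sequence.\<close>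
  have deg_mono: "deg E j \<le> deg E i" if "i \<le> j" for i j
  proof (cases "j < k")
    case True
    then show ?thesis
      using Dis_k_gap[OF ab(1) that True] degK that by simp
  next
    case False
    then obtain y where y: "j = k + y"
      using le_Suc_ex not_less by blast
    show ?thesis
    proof (cases "i < k")
      case True
      then show ?thesis
        using degK_ge[of i] h_le[of y] by (simp add: y degR)
    next
      case False
      then obtain x where "i = k + x"
        using le_Suc_ex not_less by blast
      then show ?thesis
        using that h_mono by (simp add: y degR)
    qed
  qed
  define \<pi> where "\<pi> = map (deg E) [0..<k + b 0]"
  have V: "V = set [0..<k + b 0]"
    by (auto simp: V_def)
  have sorted: "sorted_wrt (\<ge>) \<pi>"
    using deg_mono by (auto simp: \<pi>_def sorted_wrt_iff_nth_less simp del: upt.simps)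
  have ds: "degree_seq V E = \<pi>"
    unfolding V \<pi>_def using sorted by (intro degree_seq_eqI) (auto simp: \<pi>_def)
  have nth: "\<pi> ! i = deg E i" if "i < k + b 0" for i
    using that by (simp add: \<pi>_def)
  have "h 0 = k"
    using h_le[of 0] h_gt[of "k - 1" 0] b(2)[of "k - 1"] k by simp
  then have D: "sorted_wrt (\<ge>) \<pi>" "k < length \<pi>" "\<pi> ! k = k"
    using sorted b(2)[OF k] nth[of k] degR[of 0] by (simp_all add: \<pi>_def)
  have "alpha_of (degree_seq V E) = \<alpha>"
    unfolding ds durfee_alpha_of[OF D]
    using len degK nth by (intro nth_equalityI) auto
  moreover have "beta_of (degree_seq V E) = \<beta>"
  proof -
    have "conj_part \<pi> (j + 1) = \<beta> ! j + (j + 1)" if "j < k" for j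
    proof -
      have "conj_part \<pi> (j + 1) = card {v \<in> V. j < deg E v}"
        unfolding \<pi>_def V by (subst conj_part_map) (simp_all add: Suc_le_eq)
      also have "{v \<in> V. j < deg E v} = {..<k} \<union> (+) k ` {..<b j}"
      proof (intro equalityI subsetI)
        fix v assume v: "v \<in> {v \<in> V. j < deg E v}"
        show "v \<in> {..<k} \<union> (+) k ` {..<b j}"
        proof (cases "v < k")
          case False
          then obtain x where "v = k + x"
            using le_Suc_ex not_less by blast
          with v h_gt[OF that] show ?thesis by (auto simp: degR)
        qed simp
      next
        fix v assume "v \<in> {..<k} \<union> (+) k ` {..<b j}"
        then show "v \<in> {v \<in> V. j < deg E v}"
          using that h_gt[OF that] degK_ge b_mono[of 0 j]
          by (auto simp: V_def degR intro: order.strict_trans2)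
      qed
      also have "card \<dots> = k + b j"
        by (subst card_Un_disjoint) (auto simp: card_image)
      finally show ?thesis
        using b(1)[OF that] by simp
    qed
    then show ?thesis
      unfolding ds durfee_beta_of[OF D] using len by (intro nth_equalityI) auto
  qed
  moreover have "no_isolated V E"
    unfolding no_isolated_def
  proof
    fix v assume "v \<in> V"
    have "0 < deg E v"
    proof (cases "v < k")
      case True
      then show ?thesis using degK_ge[of v] k by simp
    next
      case False
      then obtain x where "v = k + x"
        using le_Suc_ex not_less by blast
      with \<open>v \<in> V\<close> show ?thesis
        using h_gt[OF k, of x] by (simp add: V_def degR)
    qed
    then show "\<exists>e\<in>E. v \<in> e"
      by (auto simp: deg_def card_gt_0_iff)
  qed
  ultimately show thesis
    using that G by blast
qed

section \<open>The two kinds of NG-blocks\<close>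

lemma NG1_block_iff:
  assumes "(\<alpha>, \<beta>) \<in> A_blocks n k" "0 < k"
  shows "NG1_block (\<alpha>, \<beta>) \<longleftrightarrow> \<beta> ! (k - 1) = 1"
proof
  assume "NG1_block (\<alpha>, \<beta>)"
  then show "\<beta> ! (k - 1) = 1"
    using graph_of_block(2) assms
    by (auto simp: NG1_block_def NG1_graph_def NG_graph_def)
next
  assume "\<beta> ! (k - 1) = 1"
  moreover obtain V :: "nat set" and E where "fin_graph V E" "no_isolated V E"
    "alpha_of (degree_seq V E) = \<alpha>" "beta_of (degree_seq V E) = \<beta>"
    using block_realizable[OF assms] by blast
  ultimately show "NG1_block (\<alpha>, \<beta>)"
    using graph_of_block(1,2)[of V E k n] assms
    by (auto simp: NG1_block_def NG1_graph_def)
qed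

lemma NG2_block_iff:
  assumes "(\<alpha>, \<beta>) \<in> A_blocks n k" "0 < k"
  shows "NG2_block (\<alpha>, \<beta>) \<longleftrightarrow> 2 \<le> \<alpha> ! (k - 1)"
proof
  assume "NG2_block (\<alpha>, \<beta>)"
  then show "2 \<le> \<alpha> ! (k - 1)"
    using graph_of_block(3) assms
    by (auto simp: NG2_block_def NG2_graph_def NG_graph_def)
next
  assume "2 \<le> \<alpha> ! (k - 1)"
  moreover obtain V :: "nat set" and E where "fin_graph V E" "no_isolated V E"
    "alpha_of (degree_seq V E) = \<alpha>" "beta_of (degree_seq V E) = \<beta>"
    using block_realizable[OF assms] by blast
  ultimately show "NG2_block (\<alpha>, \<beta>)"
    using graph_of_block(1,3)[of V E k n] assms
    by (auto simp: NG2_block_def NG2_graph_def)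
qed

lemma diagonal_in_A_blocks: "\<gamma> \<in> Dis_k k n \<Longrightarrow> (\<gamma>, \<gamma>) \<in> A_blocks n k"
  by (auto simp: A_blocks_def S_Block_def Dis_k_def majorizes_def)

lemma majorizes_refl: "\<gamma> \<succeq> \<gamma>"
  by (simp add: majorizes_def)

text \<open>The witness above an NG-1 block is its own \<open>\<beta>\<close>, which has the last part \<open>1\<close>; conversely \<open>\<beta> \<succeq> \<gamma>\<close>
  bounds the last part of \<open>\<beta>\<close> by that of \<open>\<gamma>\<close>.\<close>

lemma NG1_eq_below_diagonal:
  assumes "0 < k"
  shows "NG1 n k = {X \<in> A_blocks n k.
    \<exists>\<gamma> \<in> Dis_k k n. NG1_block (\<gamma>, \<gamma>) \<and> \<gamma> \<succeq> fst X \<and> snd X \<succeq> \<gamma>}" (is "_ = ?R")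
proof
  show "NG1 n k \<subseteq> ?R"
  proof
    fix X assume "X \<in> NG1 n k"
    then obtain \<alpha> \<beta> where X: "X = (\<alpha>, \<beta>)" "(\<alpha>, \<beta>) \<in> A_blocks n k" "\<beta> ! (k - 1) = 1"
      using NG1_block_iff[OF _ assms] by (cases X) (auto simp: NG1_def)
    then have "\<beta> \<in> Dis_k k n" "\<beta> \<succeq> \<alpha>"
      by (auto simp: A_blocks_def S_Block_def)
    moreover from this have "NG1_block (\<beta>, \<beta>)"
      using NG1_block_iff[OF diagonal_in_A_blocks assms] X(3) by blast
    ultimately show "X \<in> ?R"
      using X majorizes_refl by auto
  qed
  show "?R \<subseteq> NG1 n k"
  proof
    fix X assume "X \<in> ?R"
    then obtain \<alpha> \<beta> \<gamma> where X: "X = (\<alpha>, \<beta>)" "(\<alpha>, \<beta>) \<in> A_blocks n k"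
      and \<gamma>: "\<gamma> \<in> Dis_k k n" "NG1_block (\<gamma>, \<gamma>)" "\<beta> \<succeq> \<gamma>"
      by (cases X) auto
    have \<beta>: "\<beta> \<in> Dis_k k n"
      using X(2) by (auto simp: A_blocks_def)
    have "\<gamma> ! (k - 1) = 1"
      using NG1_block_iff[OF diagonal_in_A_blocks assms] \<gamma>(1,2) by blast
    moreover have "0 < \<beta> ! (k - 1)"
      using \<beta> assms by (auto simp: Dis_k_iff)
    ultimately have "\<beta> ! (k - 1) = 1"
      using majorizes_last_part[OF \<gamma>(1) \<beta> \<gamma>(3) assms] by linarith
    then show "X \<in> NG1 n k"
      using X NG1_block_iff[OF X(2) assms] by (simp add: NG1_def)
  qed
qed

text \<open>The witness above an NG-2 block is its own \<open>\<alpha>\<close>, since the criterion bounds the last part of \<open>\<alpha>\<close> from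
  below and \<open>\<gamma> \<succeq> \<alpha>\<close> bounds it by that of \<open>\<gamma>\<close>.\<close>

lemma NG2_eq_below_diagonal:
  assumes "0 < k"
  shows "NG2 n k = {X \<in> A_blocks n k.
    \<exists>\<gamma> \<in> Dis_k k n. NG2_block (\<gamma>, \<gamma>) \<and> \<gamma> \<succeq> fst X \<and> snd X \<succeq> \<gamma>}" (is "_ = ?R")
proof
  show "NG2 n k \<subseteq> ?R"
  proof
    fix X assume "X \<in> NG2 n k"
    then obtain \<alpha> \<beta> where X: "X = (\<alpha>, \<beta>)" "(\<alpha>, \<beta>) \<in> A_blocks n k" "2 \<le> \<alpha> ! (k - 1)"
      using NG2_block_iff[OF _ assms] by (cases X) (auto simp: NG2_def)
    then have "\<alpha> \<in> Dis_k k n" "\<beta> \<succeq> \<alpha>"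
      by (auto simp: A_blocks_def S_Block_def)
    moreover from this have "NG2_block (\<alpha>, \<alpha>)"
      using NG2_block_iff[OF diagonal_in_A_blocks assms] X(3) by blast
    ultimately show "X \<in> ?R"
      using X majorizes_refl by auto
  qed
  show "?R \<subseteq> NG2 n k"
  proof
    fix X assume "X \<in> ?R"
    then obtain \<alpha> \<beta> \<gamma> where X: "X = (\<alpha>, \<beta>)" "(\<alpha>, \<beta>) \<in> A_blocks n k"
      and \<gamma>: "\<gamma> \<in> Dis_k k n" "NG2_block (\<gamma>, \<gamma>)" "\<gamma> \<succeq> \<alpha>"
      by (cases X) auto
    have \<alpha>: "\<alpha> \<in> Dis_k k n"
      using X(2) by (auto simp: A_blocks_def)
    have "2 \<le> \<gamma> ! (k - 1)"
      using NG2_block_iff[OF diagonal_in_A_blocks assms] \<gamma>(1,2) by blast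
    then have "2 \<le> \<alpha> ! (k - 1)"
      using majorizes_last_part[OF \<alpha> \<gamma>(1,3) assms] by linarith
    then show "X \<in> NG2 n k"
      using X NG2_block_iff[OF X(2) assms] by (simp add: NG2_def)
  qed
qed

theorem theorem4p23:
  fixes n k :: nat
  assumes "n > 0" and "k > 0" and "n \<ge> (k + 1) choose 2"
  shows "amphora (S_Block n) (\<lambda>X Y. Y \<succeq>\<^sub>B X) (NG1 n k) \<and>
         NG1 n k = {X \<in> S_Block n. X \<succeq>\<^sub>B (tau k n, tau' k n) \<and>
                      (\<exists>Y \<in> Max_blocks n k. NG1_block Y \<and> Y \<succeq>\<^sub>B X)} \<and>
         amphora (S_Block n) (\<lambda>X Y. Y \<succeq>\<^sub>B X) (NG2 n k) \<and>
         NG2 n k = {X \<in> S_Block n. X \<succeq>\<^sub>B (tau k n, tau' k n) \<and>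
                      (\<exists>Y \<in> Max_blocks n k. NG2_block Y \<and> Y \<succeq>\<^sub>B X)}"
proof -
  have "NG1 n k = {X \<in> S_Block n. X \<succeq>\<^sub>B (tau k n, tau' k n) \<and>
      (\<exists>Y \<in> Max_blocks n k. NG1_block Y \<and> Y \<succeq>\<^sub>B X)}"
    using NG1_eq_below_diagonal[OF assms(2)] interval_eq[OF assms(2,3), of NG1_block] by simp
  moreover have "NG2 n k = {X \<in> S_Block n. X \<succeq>\<^sub>B (tau k n, tau' k n) \<and>
      (\<exists>Y \<in> Max_blocks n k. NG2_block Y \<and> Y \<succeq>\<^sub>B X)}"
    using NG2_eq_below_diagonal[OF assms(2)] interval_eq[OF assms(2,3), of NG2_block] by simp
  ultimately show ?thesis
    using amphora_interval[OF assms(2,3), of NG1_block]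
      amphora_interval[OF assms(2,3), of NG2_block] by simp
qed

end
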